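(* Let $p>a\ge 1$ be integers. For $i=1,\dots,a$ let $\eta_i=\sigma_1^{g_{i,1}}\sigma_2^{g_{i,2}}\cdots\sigma_{p-a-1}^{g_{i,p-a-1}}$, where each $g_{i,j}\in\{1,-1\}$ ($i=1,\dots,a$, $j=1,\dots,p-a-1$), and for $j\ge p-a$ let $\kappa_j=\sigma_{p-a}\sigma_{p-a+1}\cdots\sigma_j$. Then the $p$-braid $$\eta_1\kappa_{p-1}\;\eta_2\kappa_{p-2}\sigma_{p-1}^{-1}\;\cdots\;\eta_a\kappa_{p-a}\sigma_{p-a+1}^{-1}\cdots\sigma_{p-2}^{-1}\sigma_{p-1}^{-1}$$ (whose $i$-th factor, $1\le i\le a$, is $\eta_i\,\kappa_{p-i}\,\sigma_{p-i+1}^{-1}\sigma_{p-i+2}^{-1}\cdots\sigma_{p-1}^{-1}$) is Markov equivalent to the $(p-a)$-braid $\eta_1\eta_2\cdots\eta_a$.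
   Context: $\sigma_1,\dots,\sigma_{n-1}$ denote the elementary generators of the $n$-string braid group $\mathbb{B}_n$; empty products are trivial. Markov equivalence $\sim_M$ is the equivalence relation on $\bigsqcup_n\mathbb{B}_n$ generated by conjugation ($M_1$: $\beta\sim_M\gamma\beta\gamma^{-1}$ for $\beta,\gamma\in\mathbb{B}_n$) and stabilization ($M_2$: $\beta\sim_M\beta\sigma_n^{\pm1}$ for $\beta\in\mathbb{B}_n$, with $\beta\sigma_n^{\pm 1}\in\mathbb{B}_{n+1}$). *)

theory Defs
  imports "HOL-Algebra.Group"
begin

text \<open>The letter \<open>(i, True)\<close> stands for the generator \<open>\<sigma>\<^sub>i\<close>, and \<open>(i, False)\<close> for its inverse.\<close>

type_synonym braid_word = "(nat \<times> bool) list"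

definition braid_words :: "nat \<Rightarrow> braid_word set" where
  "braid_words n = lists ({1..<n} \<times> UNIV)"

inductive artin_relation :: "braid_word \<Rightarrow> braid_word \<Rightarrow> bool" where
  cancel: "artin_relation [(i, b), (i, \<not> b)] []"
| far: "i + 2 \<le> j \<Longrightarrow> artin_relation [(i, True), (j, True)] [(j, True), (i, True)]"
| braid: "artin_relation [(i, True), (i + 1, True), (i, True)]
                         [(i + 1, True), (i, True), (i + 1, True)]"

inductive braid_step :: "nat \<Rightarrow> braid_word \<Rightarrow> braid_word \<Rightarrow> bool" for n where
  "artin_relation r s \<Longrightarrow> u @ r @ v \<in> braid_words n \<Longrightarrow> u @ s @ v \<in> braid_words n \<Longrightarrow>
   braid_step n (u @ r @ v) (u @ s @ v)"

definition braid_rel :: "nat \<Rightarrow> (braid_word \<times> braid_word) set" where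
  "braid_rel n = {(v, w). v \<in> braid_words n \<and> w \<in> braid_words n \<and> equivclp (braid_step n) v w}"

type_synonym braid = "braid_word set"

definition braid_class :: "nat \<Rightarrow> braid_word \<Rightarrow> braid" where
  "braid_class n w = braid_rel n `` {w}"

definition braid_group :: "nat \<Rightarrow> braid monoid" where
  "braid_group n =
     \<lparr>carrier = braid_words n // braid_rel n,
      monoid.mult = (\<lambda>X Y. \<Union>v\<in>X. \<Union>w\<in>Y. braid_class n (v @ w)),
      one = braid_class n []\<rparr>"

definition sigma :: "nat \<Rightarrow> nat \<Rightarrow> braid" where
  "sigma n i = braid_class n [(i, True)]"

text \<open>The standard homomorphism from \<open>braid_group n\<close> to \<open>braid_group (Suc n)\<close>, which adds a
  trivial last strand and so does not change words.\<close>

definition add_strand :: "nat \<Rightarrow> braid \<Rightarrow> braid" where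
  "add_strand n X = braid_rel (Suc n) `` X"

text \<open>The pair \<open>(n, \<beta>)\<close> is the element \<open>\<beta>\<close> of \<open>braid_group n\<close> regarded as an element of the
  disjoint union of all braid groups on at least one strand.\<close>

inductive markov_move :: "nat \<times> braid \<Rightarrow> nat \<times> braid \<Rightarrow> bool" where
  conjugation:
    "n \<ge> 1 \<Longrightarrow> \<beta> \<in> carrier (braid_group n) \<Longrightarrow> \<gamma> \<in> carrier (braid_group n) \<Longrightarrow>
     markov_move (n, \<beta>) (n, \<gamma> \<otimes>\<^bsub>braid_group n\<^esub> \<beta> \<otimes>\<^bsub>braid_group n\<^esub> inv\<^bsub>braid_group n\<^esub> \<gamma>)"
| stabilization:
    "n \<ge> 1 \<Longrightarrow> \<beta> \<in> carrier (braid_group n) \<Longrightarrow> \<epsilon> \<in> {1, -1 :: int} \<Longrightarrow>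
     markov_move (n, \<beta>)
       (n + 1, add_strand n \<beta> \<otimes>\<^bsub>braid_group (n + 1)\<^esub>
                 (sigma (n + 1) n [^]\<^bsub>braid_group (n + 1)\<^esub> \<epsilon>))"

definition markov_equivalent :: "nat \<times> braid \<Rightarrow> nat \<times> braid \<Rightarrow> bool" (infix "\<sim>\<^sub>M" 50) where
  "x \<sim>\<^sub>M y \<longleftrightarrow> equivclp markov_move x y"

definition ordered_prod :: "('a, 'b) monoid_scheme \<Rightarrow> 'a list \<Rightarrow> 'a" where
  "ordered_prod G xs = foldr (mult G) xs \<one>\<^bsub>G\<^esub>"

text \<open>In the next three definitions \<open>n\<close> is the number of strands. Note that a list \<open>[k..<l]\<close>
  with \<open>l \<le> k\<close> is empty.\<close>

definition eta :: "nat \<Rightarrow> nat \<Rightarrow> (nat \<Rightarrow> int) \<Rightarrow> braid" where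
  "eta n m e = ordered_prod (braid_group n) (map (\<lambda>j. sigma n j [^]\<^bsub>braid_group n\<^esub> e j) [1..<m + 1])"

definition kappa :: "nat \<Rightarrow> nat \<Rightarrow> nat \<Rightarrow> braid" where
  "kappa n k j = ordered_prod (braid_group n) (map (sigma n) [k..<j + 1])"

definition neg_run :: "nat \<Rightarrow> nat \<Rightarrow> nat \<Rightarrow> braid" where
  "neg_run n k j =
     ordered_prod (braid_group n) (map (\<lambda>l. inv\<^bsub>braid_group n\<^esub> (sigma n l)) [k..<j + 1])"

lemma braid_words_append [simp]:
  "v @ w \<in> braid_words n \<longleftrightarrow> v \<in> braid_words n \<and> w \<in> braid_words n"
  by (auto simp: braid_words_def)

lemma braid_words_Nil [simp]: "[] \<in> braid_words n"
  by (simp add: braid_words_def)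

lemma braid_words_Cons [simp]:
  "(i, b) # w \<in> braid_words n \<longleftrightarrow> 1 \<le> i \<and> i < n \<and> w \<in> braid_words n"
  by (auto simp: braid_words_def)

lemma braid_words_mono: "m \<le> n \<Longrightarrow> w \<in> braid_words m \<Longrightarrow> w \<in> braid_words n"
  by (auto simp: braid_words_def lists_eq_set)

lemma equiv_braid_rel: "equiv (braid_words n) (braid_rel n)"
proof (intro equivI)
  show "refl_on (braid_words n) (braid_rel n)"
    by (simp add: refl_on_def braid_rel_def)
  show "sym (braid_rel n)"
    by (rule symI) (simp add: braid_rel_def equivclp_sym)
  show "trans (braid_rel n)"
    by (rule transI) (simp add: braid_rel_def, blast intro: equivclp_trans)
qed (auto simp: braid_rel_def)

lemma braid_step_context:
  assumes "braid_step n v w" "x \<in> braid_words n" "y \<in> braid_words n"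
  shows "braid_step n (x @ v @ y) (x @ w @ y)"
  using assms(1)
proof cases
  case (1 r s u u')
  then show ?thesis
    using braid_step.intros[of r s "x @ u" "u' @ y" n] assms by simp
qed

lemma equivclp_braid_step_context:
  assumes "equivclp (braid_step n) v w" "x \<in> braid_words n" "y \<in> braid_words n"
  shows "equivclp (braid_step n) (x @ v @ y) (x @ w @ y)"
  using assms(1)
proof (induction rule: equivclp_induct)
  case (step w w')
  then show ?case
    using braid_step_context[OF _ assms(2,3)] by (meson equivclp_trans r_into_equivclp equivclp_sym)
qed simp

lemma braid_rel_append:
  assumes "(v, v') \<in> braid_rel n" "(w, w') \<in> braid_rel n"
  shows "(v @ w, v' @ w') \<in> braid_rel n"
proof -
  have "equivclp (braid_step n) (v @ w) (v' @ w)"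
    using assms equivclp_braid_step_context[of n v v' "[]" w] by (simp add: braid_rel_def)
  moreover have "equivclp (braid_step n) (v' @ w) (v' @ w')"
    using assms equivclp_braid_step_context[of n w w' v' "[]"] by (simp add: braid_rel_def)
  ultimately have "equivclp (braid_step n) (v @ w) (v' @ w')"
    by (rule equivclp_trans)
  then show ?thesis
    using assms by (simp add: braid_rel_def)
qed

lemma braid_class_eq_iff:
  "v \<in> braid_words n \<Longrightarrow> w \<in> braid_words n \<Longrightarrow>
   braid_class n v = braid_class n w \<longleftrightarrow> equivclp (braid_step n) v w"
  unfolding braid_class_def
  using eq_equiv_class_iff[OF equiv_braid_rel, of v n w] by (simp add: braid_rel_def)

lemma braid_class_in_carrier [simp]:
  "w \<in> braid_words n \<Longrightarrow> braid_class n w \<in> carrier (braid_group n)"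
  by (simp add: braid_group_def braid_class_def quotientI)

lemma braid_group_cases:
  assumes "X \<in> carrier (braid_group n)"
  obtains w where "w \<in> braid_words n" "X = braid_class n w"
proof -
  have "X \<in> braid_words n // braid_rel n"
    using assms by (simp add: braid_group_def)
  then show thesis
    by (rule quotientE) (use that in \<open>simp add: braid_class_def\<close>)
qed

lemma braid_group_one: "\<one>\<^bsub>braid_group n\<^esub> = braid_class n []"
  by (simp add: braid_group_def)

lemma braid_group_mult:
  assumes "v \<in> braid_words n" "w \<in> braid_words n"
  shows "braid_class n v \<otimes>\<^bsub>braid_group n\<^esub> braid_class n w = braid_class n (v @ w)"
proof -
  have "v \<in> braid_class n v" "w \<in> braid_class n w"
    using assms by (simp_all add: braid_class_def braid_rel_def)
  moreover have "braid_class n (v' @ w') = braid_class n (v @ w)"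
    if "v' \<in> braid_class n v" "w' \<in> braid_class n w" for v' w'
  proof -
    have "(v @ w, v' @ w') \<in> braid_rel n"
      using that by (intro braid_rel_append) (simp_all add: braid_class_def)
    then show ?thesis
      unfolding braid_class_def by (rule equiv_class_eq[OF equiv_braid_rel, symmetric])
  qed
  ultimately have "(\<Union>v'\<in>braid_class n v. \<Union>w'\<in>braid_class n w. braid_class n (v' @ w')) =
      braid_class n (v @ w)"
    by blast
  then show ?thesis
    by (simp add: braid_group_def)
qed

definition inverse_word :: "braid_word \<Rightarrow> braid_word" where
  "inverse_word w = rev (map (\<lambda>(i, b). (i, \<not> b)) w)"

lemma inverse_word_in [simp]: "w \<in> braid_words n \<Longrightarrow> inverse_word w \<in> braid_words n"
  by (auto simp: braid_words_def inverse_word_def lists_eq_set)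

lemma inverse_word_cancel:
  "w \<in> braid_words n \<Longrightarrow> equivclp (braid_step n) (inverse_word w @ w) []"
proof (induction w)
  case (Cons x w)
  obtain i b where x: "x = (i, b)" by force
  have "braid_step n (inverse_word w @ [(i, \<not> b), (i, \<not> \<not> b)] @ w) (inverse_word w @ [] @ w)"
    using Cons.prems x by (intro braid_step.intros artin_relation.cancel) auto
  then have "equivclp (braid_step n) (inverse_word (x # w) @ x # w) (inverse_word w @ w)"
    by (simp add: inverse_word_def x r_into_equivclp)
  moreover have "equivclp (braid_step n) (inverse_word w @ w) []"
    using Cons.IH Cons.prems x by simp
  ultimately show ?case
    by (rule equivclp_trans)
qed (simp add: inverse_word_def)

lemma group_braid_group: "group (braid_group n)"
proof (rule groupI)
  fix X assume "X \<in> carrier (braid_group n)"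
  then obtain w where w: "w \<in> braid_words n" "X = braid_class n w"
    by (rule braid_group_cases)
  show "\<exists>Y\<in>carrier (braid_group n). Y \<otimes>\<^bsub>braid_group n\<^esub> X = \<one>\<^bsub>braid_group n\<^esub>"
    using w inverse_word_cancel[of w n]
    by (intro bexI[of _ "braid_class n (inverse_word w)"])
       (simp_all add: braid_group_mult braid_group_one braid_class_eq_iff)
qed (auto elim!: braid_group_cases simp: braid_group_mult braid_group_one)

lemma inv_braid_class:
  "w \<in> braid_words n \<Longrightarrow> inv\<^bsub>braid_group n\<^esub> (braid_class n w) = braid_class n (inverse_word w)"
  by (intro group.inv_equality[OF group_braid_group])
     (simp_all add: braid_group_mult braid_group_one braid_class_eq_iff inverse_word_cancel)

lemma sigma_in_carrier [simp]: "1 \<le> i \<Longrightarrow> i < n \<Longrightarrow> sigma n i \<in> carrier (braid_group n)"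
  by (simp add: sigma_def)

lemma braid_step_Suc: "braid_step n v w \<Longrightarrow> braid_step (Suc n) v w"
  by (auto elim!: braid_step.cases intro!: braid_step.intros intro: braid_words_mono[of n "Suc n"])

lemma braid_rel_Suc: "braid_rel n \<subseteq> braid_rel (Suc n)"
proof -
  have "equivclp (braid_step (Suc n)) v w" if "equivclp (braid_step n) v w" for v w
    using that
  proof (induction rule: equivclp_induct)
    case (step w w')
    then show ?case
      by (meson braid_step_Suc equivclp_trans r_into_equivclp equivclp_sym)
  qed simp
  then show ?thesis
    by (auto simp: braid_rel_def intro: braid_words_mono[of n "Suc n"])
qed

lemma add_strand_class:
  assumes "w \<in> braid_words n"
  shows "add_strand n (braid_class n w) = braid_class (Suc n) w"
proof
  show "add_strand n (braid_class n w) \<subseteq> braid_class (Suc n) w"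
    using braid_rel_Suc[of n] equiv_braid_rel[of "Suc n"]
    unfolding add_strand_def braid_class_def equiv_def by (meson Image_singleton_iff ImageE subsetD subsetI transD)
  show "braid_class (Suc n) w \<subseteq> add_strand n (braid_class n w)"
    using assms by (auto simp: add_strand_def braid_class_def braid_rel_def)
qed

lemma add_strand_hom: "add_strand n \<in> hom (braid_group n) (braid_group (Suc n))"
  by (rule homI)
     (auto elim!: braid_group_cases simp: add_strand_class braid_group_mult
       braid_words_mono[of n "Suc n"])

lemma add_strand_sigma: "1 \<le> i \<Longrightarrow> i < n \<Longrightarrow> add_strand n (sigma n i) = sigma (Suc n) i"
  by (simp add: sigma_def add_strand_class)

end

theory Submission
  imports Defs
begin

text \<open>Let \<open>k = p - a\<close>, and let \<open>F\<^sub>i\<close> be the part of the \<open>i\<close>-th factor that follows \<open>\<eta>\<^sub>i\<close>, so that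
  \<open>F\<^sub>1 = F'\<^sub>1 \<sigma>\<^bsub>p-1\<^esub>\<close> and \<open>F\<^bsub>i+1\<^esub> = F'\<^sub>i \<sigma>\<^bsub>p-1\<^esub>\<^sup>-\<^sup>1\<close>, where \<open>F'\<^sub>i\<close> is the analogue of \<open>F\<^sub>i\<close> on \<open>p - 1\<close> strands.
  Put \<open>D\<^sub>i = \<sigma>\<^bsub>p-1\<^esub> \<cdots> \<sigma>\<^bsub>p-i\<^esub>\<close>. The braid relations give
  \<open>D\<^sub>i \<eta>\<^bsub>i+1\<^esub> F\<^bsub>i+1\<^esub> = \<eta>\<^bsub>i+1\<^esub> F'\<^bsub>i+1\<^esub> D\<^bsub>i+1\<^esub>\<close>, so the whole braid is \<open>\<eta>\<^sub>1 F'\<^sub>1 \<cdots> \<eta>\<^sub>a F'\<^sub>a D\<^sub>a\<close>.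
  Here \<open>F'\<^sub>a = \<sigma>\<^sub>k\<^sup>-\<^sup>1 \<cdots> \<sigma>\<^bsub>p-2\<^esub>\<^sup>-\<^sup>1\<close> and \<open>D\<^sub>a = \<sigma>\<^bsub>p-1\<^esub> F'\<^sub>a\<^sup>-\<^sup>1\<close>. The only letter \<open>\<sigma>\<^bsub>p-1\<^esub>\<close> is now removed
  by a conjugation and a destabilization, which leaves \<open>\<eta>\<^sub>a \<eta>\<^sub>1 F'\<^sub>1 \<eta>\<^sub>2 F'\<^sub>2 \<cdots> \<eta>\<^bsub>a-1\<^esub> F'\<^bsub>a-1\<^esub>\<close> up to
  conjugation. This has the same form with \<open>a - 1\<close> factors, the first \<open>\<eta>\<close> being \<open>\<eta>\<^sub>a \<eta>\<^sub>1\<close>; only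
  \<open>\<eta>\<^sub>i \<in> B\<^sub>k\<close> is used, so induction on \<open>a\<close> applies.\<close>

section \<open>Equality of braid words modulo the braid relations\<close>

definition braid_eq :: "nat \<Rightarrow> braid_word \<Rightarrow> braid_word \<Rightarrow> bool" where
  "braid_eq n v w \<longleftrightarrow> (v, w) \<in> braid_rel n"

lemma braid_eq_refl: "w \<in> braid_words n \<Longrightarrow> braid_eq n w w"
  by (simp add: braid_eq_def braid_rel_def)

lemma braid_eq_sym: "braid_eq n v w \<Longrightarrow> braid_eq n w v"
  by (simp add: braid_eq_def braid_rel_def equivclp_sym)

lemma braid_eq_trans [trans]: "braid_eq n u v \<Longrightarrow> braid_eq n v w \<Longrightarrow> braid_eq n u w"
  using equiv_braid_rel[of n] unfolding braid_eq_def by (meson equiv_def transD)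

lemma braid_eq_words:
  assumes "braid_eq n v w"
  shows "v \<in> braid_words n" "w \<in> braid_words n"
  using assms by (simp_all add: braid_eq_def braid_rel_def)

lemma braid_eq_context:
  assumes "braid_eq n v w" "x \<in> braid_words n" "y \<in> braid_words n"
  shows "braid_eq n (x @ v @ y) (x @ w @ y)"
  using assms braid_eq_refl unfolding braid_eq_def by (intro braid_rel_append)

lemma braid_eq_artin:
  assumes "artin_relation r s" "r \<in> braid_words n" "s \<in> braid_words n"
  shows "braid_eq n r s"
  using assms braid_step.intros[of r s "[]" "[]" n] by (simp add: braid_eq_def braid_rel_def r_into_equivclp)

lemma braid_class_eqI: "braid_eq n v w \<Longrightarrow> braid_class n v = braid_class n w"
  by (simp add: braid_class_eq_iff braid_eq_def braid_rel_def)

lemma inverse_word_inverse_word [simp]: "inverse_word (inverse_word w) = w"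
  by (induction w) (auto simp: inverse_word_def)

lemma braid_eq_inverse_left: "w \<in> braid_words n \<Longrightarrow> braid_eq n (inverse_word w @ w) []"
  using inverse_word_cancel by (simp add: braid_eq_def braid_rel_def)

lemma braid_eq_inverse_right: "w \<in> braid_words n \<Longrightarrow> braid_eq n (w @ inverse_word w) []"
  using braid_eq_inverse_left[of "inverse_word w"] by simp

text \<open>The hypothesis says that conjugation by \<open>x\<close> takes \<open>v\<close> to
  \<open>w\<close>, so it takes inverse to inverse. This carries relations given for positive
  letters over to negative ones.\<close>

lemma braid_eq_move_inverse:
  assumes "braid_eq n (x @ v) (w @ x)"
  shows "braid_eq n (x @ inverse_word v) (inverse_word w @ x)"
proof -
  have words: "x \<in> braid_words n" "v \<in> braid_words n" "w \<in> braid_words n"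
    using braid_eq_words[OF assms] by auto
  have "braid_eq n (x @ inverse_word v) (inverse_word w @ w @ x @ inverse_word v)"
    using braid_eq_context[OF braid_eq_inverse_left[OF words(3)], of "[]" "x @ inverse_word v"] words
    by (simp add: braid_eq_sym)
  also have "braid_eq n \<dots> (inverse_word w @ x @ v @ inverse_word v)"
    using braid_eq_context[OF braid_eq_sym[OF assms], of "inverse_word w" "inverse_word v"] words
    by simp
  also have "braid_eq n \<dots> (inverse_word w @ x)"
    using braid_eq_context[OF braid_eq_inverse_right[OF words(2)], of "inverse_word w @ x" "[]"] words
    by simp
  finally show ?thesis .
qed

text \<open>\<open>artin_relation.far\<close> covers positive letters only;
  \<open>braid_eq_move_inverse\<close> changes the sign of \<open>j\<close> first and then, with the
  sides exchanged, that of \<open>i\<close>.\<close>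

lemma braid_eq_far:
  assumes "i + 2 \<le> j" "1 \<le> i" "j < n"
  shows "braid_eq n [(i, b), (j, c)] [(j, c), (i, b)]"
proof -
  have inverse: "inverse_word [(l, True)] = [(l, False)]" for l
    by (simp add: inverse_word_def)
  have "braid_eq n ([(i, True)] @ [(j, True)]) ([(j, True)] @ [(i, True)])"
    using assms by (intro braid_eq_artin) (auto intro: artin_relation.far)
  then have i_pos: "braid_eq n ([(i, True)] @ [(j, c)]) ([(j, c)] @ [(i, True)])"
    using braid_eq_move_inverse[of n "[(i, True)]" "[(j, True)]" "[(j, True)]"]
    by (cases c) (simp_all add: inverse)
  then show ?thesis
    using braid_eq_move_inverse[OF braid_eq_sym[OF i_pos]]
    by (cases b) (simp_all add: inverse braid_eq_sym)
qed

lemma braid_eq_commute_letter: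
  assumes "x \<in> braid_words n" "1 \<le> j" "j < n" "\<And>i b. (i, b) \<in> set x \<Longrightarrow> i + 2 \<le> j \<or> j + 2 \<le> i"
  shows "braid_eq n (x @ [(j, c)]) ((j, c) # x)"
  using assms(1,4)
proof (induction x)
  case Nil
  then show ?case
    using assms(2,3) by (simp add: braid_eq_refl)
next
  case (Cons y x)
  obtain i b where y: "y = (i, b)"
    by force
  have i: "1 \<le> i" "i < n" and x: "x \<in> braid_words n" and apart: "i + 2 \<le> j \<or> j + 2 \<le> i"
    using Cons.prems y by auto
  have "braid_eq n (x @ [(j, c)]) ((j, c) # x)"
    using Cons by (auto simp: y)
  then have "braid_eq n (y # x @ [(j, c)]) ([y, (j, c)] @ x)"
    using braid_eq_context[of n _ _ "[y]" "[]"] i y by fastforce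
  also have "braid_eq n [y, (j, c)] [(j, c), y]"
    using braid_eq_far[of i j] braid_eq_far[of j i] apart i assms(2,3) y by (auto intro: braid_eq_sym)
  then have "braid_eq n ([y, (j, c)] @ x) ((j, c) # y # x)"
    using braid_eq_context[of n _ _ "[]" x] x by fastforce
  finally show ?case
    by simp
qed

lemma braid_eq_commute:
  assumes "x \<in> braid_words n" "w \<in> braid_words n"
    and "\<And>i b j c. (i, b) \<in> set x \<Longrightarrow> (j, c) \<in> set w \<Longrightarrow> i + 2 \<le> j \<or> j + 2 \<le> i"
  shows "braid_eq n (x @ w) (w @ x)"
  using assms(2,3)
proof (induction w)
  case Nil
  then show ?case
    using assms(1) by (simp add: braid_eq_refl)
next
  case (Cons y w)
  obtain j c where y: "y = (j, c)"
    by force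
  have j: "1 \<le> j" "j < n" and w: "w \<in> braid_words n"
    using Cons.prems y by auto
  have "braid_eq n (x @ [y]) ([y] @ x)"
    using braid_eq_commute_letter[of x n j c] assms(1) j Cons.prems y by fastforce
  then have "braid_eq n (x @ y # w) (y # x @ w)"
    using braid_eq_context[of n _ _ "[]" w] w by fastforce
  also have "braid_eq n (x @ w) (w @ x)"
    using Cons by (metis w list.set_intros(2))
  then have "braid_eq n (y # x @ w) (y # w @ x)"
    using braid_eq_context[of n _ _ "[y]" "[]"] j y by fastforce
  finally show ?case
    by simp
qed

section \<open>Monotone words and the index shift by a descending word\<close>

text \<open>The half-open range lets adjacent words concatenate without index corrections. The
  descending word \<open>D\<^sub>i\<close> is \<open>rev (pos_word (p - i) p)\<close>.\<close>

definition pos_word :: "nat \<Rightarrow> nat \<Rightarrow> braid_word" where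
  "pos_word k l = map (\<lambda>i. (i, True)) [k..<l]"

definition neg_word :: "nat \<Rightarrow> nat \<Rightarrow> braid_word" where
  "neg_word k l = map (\<lambda>i. (i, False)) [k..<l]"

lemma pos_word_in [simp]: "1 \<le> k \<Longrightarrow> l \<le> n \<Longrightarrow> pos_word k l \<in> braid_words n"
  by (auto simp: pos_word_def braid_words_def lists_eq_set)

lemma neg_word_in [simp]: "1 \<le> k \<Longrightarrow> l \<le> n \<Longrightarrow> neg_word k l \<in> braid_words n"
  by (auto simp: neg_word_def braid_words_def lists_eq_set)

lemma rev_in_braid_words [simp]: "rev w \<in> braid_words n \<longleftrightarrow> w \<in> braid_words n"
  by (auto simp: braid_words_def lists_eq_set)

lemma inverse_word_neg_word: "inverse_word (neg_word k l) = rev (pos_word k l)"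
  by (simp add: inverse_word_def neg_word_def pos_word_def)

lemma pos_word_append: "k \<le> l \<Longrightarrow> l \<le> m \<Longrightarrow> pos_word k m = pos_word k l @ pos_word l m"
  unfolding pos_word_def by (metis le_add_diff_inverse map_append upt_add_eq_append)

lemma neg_word_append: "k \<le> l \<Longrightarrow> l \<le> m \<Longrightarrow> neg_word k m = neg_word k l @ neg_word l m"
  unfolding neg_word_def by (metis le_add_diff_inverse map_append upt_add_eq_append)

lemma pos_word_Suc [simp]: "pos_word k (Suc k) = [(k, True)]"
  by (simp add: pos_word_def)

lemma neg_word_Suc [simp]: "neg_word k (Suc k) = [(k, False)]"
  by (simp add: neg_word_def)

text \<open>The negative letter \<open>l + 1\<close> commutes with all letters below
  \<open>l\<close>, drops to \<open>l\<close> on crossing the two letters \<open>l + 1\<close> and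
  \<open>l\<close>, and then commutes with all letters above \<open>l + 1\<close>.\<close>

lemma descending_shift_letter:
  assumes "1 \<le> q" "q \<le> l" "l + 1 < m" "m \<le> n"
  shows "braid_eq n (rev (pos_word q m) @ [(l + 1, False)]) ((l, False) # rev (pos_word q m))"
proof -
  define up where "up = rev (pos_word (l + 2) m)"
  define low where "low = rev (pos_word q l)"
  have split: "rev (pos_word q m) = up @ [(l + 1, True), (l, True)] @ low"
    using assms pos_word_append[of q l m] pos_word_append[of l "l + 1" m]
      pos_word_append[of "l + 1" "l + 2" m]
    by (simp add: up_def low_def)
  have words: "up \<in> braid_words n" "low \<in> braid_words n"
    using assms by (simp_all add: up_def low_def)
  have inner: "braid_eq n ([(l + 1, True), (l, True)] @ [(l + 1, False)])
      ([(l, False)] @ [(l + 1, True), (l, True)])"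
  \<comment> \<open>The braid relation says that the word \<open>l + 1\<close>, \<open>l\<close>
    conjugates the letter \<open>l + 1\<close> to the letter \<open>l\<close>; now invert
    both.\<close>
  proof -
    have "braid_eq n ([(l + 1, True), (l, True)] @ [(l + 1, True)]) ([(l, True)] @ [(l + 1, True), (l, True)])"
      using assms by (intro braid_eq_sym[OF braid_eq_artin]) (auto intro: artin_relation.braid[simplified])
    from braid_eq_move_inverse[OF this] show ?thesis
      by (simp add: inverse_word_def)
  qed
  have "braid_eq n (low @ [(l + 1, False)]) ((l + 1, False) # low)"
    using assms words by (intro braid_eq_commute_letter) (auto simp: low_def pos_word_def)
  from braid_eq_context[OF this, of "up @ [(l + 1, True), (l, True)]" "[]"]
  have "braid_eq n (rev (pos_word q m) @ [(l + 1, False)])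
      (up @ [(l + 1, True), (l, True), (l + 1, False)] @ low)"
    using assms words by (simp add: split)
  also have "braid_eq n \<dots> (up @ [(l, False)] @ [(l + 1, True), (l, True)] @ low)"
    using braid_eq_context[OF inner, of up low] words by simp
  also have "braid_eq n (up @ [(l, False)]) ((l, False) # up)"
    using assms words by (intro braid_eq_commute_letter) (auto simp: up_def pos_word_def)
  from braid_eq_context[OF this, of "[]" "[(l + 1, True), (l, True)] @ low"]
  have "braid_eq n (up @ [(l, False)] @ [(l + 1, True), (l, True)] @ low) ((l, False) # rev (pos_word q m))"
    using assms words by (simp add: split)
  finally show ?thesis .
qed

lemma descending_shift:
  assumes "1 \<le> q" "q \<le> l" "l < m" "m \<le> n"
  shows "braid_eq n (rev (pos_word q m) @ neg_word (q + 1) (l + 1)) (neg_word q l @ rev (pos_word q m))"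
  using assms(2,3)
proof (induction l rule: nat_induct_at_least)
  case base
  then show ?case
    using assms by (simp add: neg_word_def braid_eq_refl)
next
  case (Suc l)
  have "neg_word (q + 1) (Suc l + 1) = neg_word (q + 1) (l + 1) @ [(l + 1, False)]"
    using Suc neg_word_append[of "q + 1" "l + 1" "Suc l + 1"] by simp
  moreover have "braid_eq n (rev (pos_word q m) @ neg_word (q + 1) (l + 1)) (neg_word q l @ rev (pos_word q m))"
    using Suc by simp
  from braid_eq_context[OF this, of "[]" "[(l + 1, False)]"]
  have "braid_eq n (rev (pos_word q m) @ neg_word (q + 1) (l + 1) @ [(l + 1, False)])
      (neg_word q l @ rev (pos_word q m) @ [(l + 1, False)])"
    using Suc assms by simp
  moreover have "braid_eq n (neg_word q l @ rev (pos_word q m) @ [(l + 1, False)])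
      (neg_word q l @ (l, False) # rev (pos_word q m))"
    using braid_eq_context[OF descending_shift_letter[of q l m n], of "neg_word q l" "[]"] Suc assms
    by simp
  moreover have "neg_word q (Suc l) = neg_word q l @ [(l, False)]"
    using Suc neg_word_append[of q l "Suc l"] by simp
  ultimately show ?case
    by (auto intro: braid_eq_trans)
qed

section \<open>Moving a descending word through the factors\<close>

text \<open>On \<open>n\<close> strands, \<open>pass k n i\<close> is the part of the \<open>i\<close>-th factor that follows \<open>\<eta>\<^sub>i\<close>.\<close>

definition pass :: "nat \<Rightarrow> nat \<Rightarrow> nat \<Rightarrow> braid_word" where
  "pass k n i = pos_word k (n + 1 - i) @ neg_word (n + 1 - i) n"

lemma pass_in [simp]: "1 \<le> k \<Longrightarrow> 1 \<le> i \<Longrightarrow> i \<le> n \<Longrightarrow> pass k n i \<in> braid_words n"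
  by (simp add: pass_def)

lemma pass_Suc_one: "k \<le> n \<Longrightarrow> pass k (Suc n) 1 = pass k n 1 @ [(n, True)]"
  using pos_word_append[of k n "Suc n"] by (simp add: pass_def neg_word_def)

lemma pass_Suc_Suc: "1 \<le> i \<Longrightarrow> pass k (Suc n) (Suc i) = pass k n i @ [(n, False)]"
  using neg_word_append[of "n + 1 - i" n "Suc n"] by (simp add: pass_def)

text \<open>The descending word commutes with everything up to the letter \<open>q = n - i\<close>
  of the pass. Absorbing that letter makes it longer by one, and the longer word lowers the negative
  run by one index.\<close>

lemma descending_pass:
  assumes "1 \<le> k" "1 \<le> i" "k + i \<le> n" "h \<in> braid_words k"
  shows "braid_eq (Suc n) (rev (pos_word (Suc n - i) (Suc n)) @ h @ pass k (Suc n) (Suc i))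
    (h @ pass k n (Suc i) @ rev (pos_word (n - i) (Suc n)))"
proof -
  define q where "q = n - i"
  have q: "k \<le> q" "q < n" "Suc n - i = q + 1"
    using assms by (auto simp: q_def)
  have h: "h \<in> braid_words (Suc n)"
    using assms by (auto intro: braid_words_mono[of k])
  have desc: "rev (pos_word q (Suc n)) = rev (pos_word (q + 1) (Suc n)) @ [(q, True)]"
    using q pos_word_append[of q "q + 1" "Suc n"] by simp
  have pass_old: "pass k (Suc n) (Suc i) = pos_word k q @ (q, True) # neg_word (q + 1) (Suc n)"
    using q pos_word_append[of k q "q + 1"] by (simp add: pass_def q_def)
  have pass_new: "pass k n (Suc i) = pos_word k q @ neg_word q n"
    using q by (simp add: pass_def q_def)
  have "braid_eq (Suc n) (rev (pos_word (q + 1) (Suc n)) @ (h @ pos_word k q))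
      ((h @ pos_word k q) @ rev (pos_word (q + 1) (Suc n)))"
  proof (rule braid_eq_commute)
    \<comment> \<open>The descending word has letters at least \<open>q + 1\<close>; those of
      \<open>h\<close> and \<open>pos_word k q\<close> are at most \<open>q - 1\<close>, because
      \<open>k \<le> q\<close>.\<close>
    show "i + 2 \<le> j \<or> j + 2 \<le> i"
      if "(i, b) \<in> set (rev (pos_word (q + 1) (Suc n)))" "(j, c) \<in> set (h @ pos_word k q)" for i b j c
      using that q assms(4) by (auto simp: pos_word_def braid_words_def lists_eq_set)
  qed (use assms q h in auto)
  from braid_eq_context[OF this, of "[]" "(q, True) # neg_word (q + 1) (Suc n)"]
  have "braid_eq (Suc n) (rev (pos_word (q + 1) (Suc n)) @ h @ pass k (Suc n) (Suc i))
      (h @ pos_word k q @ rev (pos_word q (Suc n)) @ neg_word (q + 1) (Suc n))"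
    using assms q by (simp add: pass_old desc)
  also have "braid_eq (Suc n) \<dots> (h @ pos_word k q @ neg_word q n @ rev (pos_word q (Suc n)))"
    using braid_eq_context[OF descending_shift[of q n "Suc n" "Suc n"], of "h @ pos_word k q" "[]"]
      assms q h by simp
  finally show ?thesis
    by (simp add: pass_new q(3) flip: q_def)
qed

definition pass_product :: "nat \<Rightarrow> nat \<Rightarrow> (nat \<Rightarrow> braid_word) \<Rightarrow> nat \<Rightarrow> braid_word" where
  "pass_product k n h m = concat (map (\<lambda>i. h i @ pass k n i) [1..<m + 1])"

lemma pass_product_Suc:
  "pass_product k n h (Suc m) = pass_product k n h m @ h (Suc m) @ pass k n (Suc m)"
  by (simp add: pass_product_def)

lemma concat_map_in_braid_words:
  "(\<And>i. i \<in> set is \<Longrightarrow> f i \<in> braid_words n) \<Longrightarrow> concat (map f is) \<in> braid_words n"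
  by (induction "is") simp_all

lemma pass_product_in:
  assumes "1 \<le> k" "k \<le> n" "m \<le> n" "\<And>i. i \<in> {1..m} \<Longrightarrow> h i \<in> braid_words k"
  shows "pass_product k n h m \<in> braid_words n"
  unfolding pass_product_def
  using assms by (intro concat_map_in_braid_words) (auto intro: braid_words_mono[of k])

lemma pass_product_descend:
  assumes "1 \<le> k" "1 \<le> m" "k + m \<le> Suc n" "\<And>i. i \<in> {1..m} \<Longrightarrow> h i \<in> braid_words k"
  shows "braid_eq (Suc n) (pass_product k (Suc n) h m)
    (pass_product k n h m @ rev (pos_word (Suc n - m) (Suc n)))"
  using assms(2-4)
proof (induction m rule: nat_induct_at_least)
  case base
  \<comment> \<open>The first factor itself ends in the positive letter \<open>n\<close>, which is
    the initial descending word, so the two sides are the same word.\<close>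
  have "pass_product k (Suc n) h 1 = pass_product k n h 1 @ rev (pos_word (Suc n - 1) (Suc n))"
    using base pass_Suc_one[of k n] by (simp add: pass_product_def)
  moreover have "pass_product k (Suc n) h 1 \<in> braid_words (Suc n)"
    using base assms(1) by (intro pass_product_in) auto
  ultimately show ?case
    by (simp add: braid_eq_refl)
next
  case (Suc m)
  let ?D = "\<lambda>j. rev (pos_word j (Suc n))"
  have h: "h (Suc m) \<in> braid_words k" "h (Suc m) \<in> braid_words (Suc n)"
    using Suc.prems by (auto intro: braid_words_mono[of k])
  have "pass_product k n h m \<in> braid_words n"
    using Suc assms(1) by (intro pass_product_in) auto
  then have P: "pass_product k n h m \<in> braid_words (Suc n)"
    by (rule braid_words_mono[rotated]) simp
  have "braid_eq (Suc n) (pass_product k (Suc n) h m) (pass_product k n h m @ ?D (Suc n - m))"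
    using Suc by simp
  from braid_eq_context[OF this, of "[]" "h (Suc m) @ pass k (Suc n) (Suc m)"]
  have "braid_eq (Suc n) (pass_product k (Suc n) h (Suc m))
      (pass_product k n h m @ ?D (Suc n - m) @ h (Suc m) @ pass k (Suc n) (Suc m))"
    using Suc assms(1) h by (simp add: pass_product_Suc)
  also have "braid_eq (Suc n) \<dots>
      (pass_product k n h m @ h (Suc m) @ pass k n (Suc m) @ ?D (n - m))"
    using braid_eq_context[OF descending_pass[of k m n "h (Suc m)"], of "pass_product k n h m" "[]"]
      Suc assms(1) h P by simp
  finally show ?case
    by (simp add: pass_product_Suc)
qed

section \<open>Markov moves on words and the induction on the number of factors\<close>

abbreviation word_markov :: "nat \<Rightarrow> braid_word \<Rightarrow> nat \<Rightarrow> braid_word \<Rightarrow> bool" where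
  "word_markov m v n w \<equiv> (m, braid_class m v) \<sim>\<^sub>M (n, braid_class n w)"

lemma markov_sym: "x \<sim>\<^sub>M y \<Longrightarrow> y \<sim>\<^sub>M x"
  by (simp add: markov_equivalent_def equivclp_sym)

lemma markov_trans [trans]: "x \<sim>\<^sub>M y \<Longrightarrow> y \<sim>\<^sub>M z \<Longrightarrow> x \<sim>\<^sub>M z"
  unfolding markov_equivalent_def by (rule equivclp_trans)

lemma word_markov_braid_eq: "braid_eq n v w \<Longrightarrow> word_markov n v n w"
  by (simp add: braid_class_eqI markov_equivalent_def)

text \<open>Conjugating \<open>v @ w\<close> by \<open>w\<close> gives \<open>w @ v\<close>, after
  \<open>w\<close> cancels against its inverse at the end.\<close>

lemma word_markov_rotate:
  assumes "1 \<le> n" "v \<in> braid_words n" "w \<in> braid_words n"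
  shows "word_markov n (v @ w) n (w @ v)"
proof -
  have "markov_move (n, braid_class n (v @ w)) (n, braid_class n (w @ (v @ w) @ inverse_word w))"
    using assms markov_move.conjugation[of n "braid_class n (v @ w)" "braid_class n w"]
    by (simp add: braid_group_mult inv_braid_class)
  moreover have "braid_class n (w @ (v @ w) @ inverse_word w) = braid_class n (w @ v)"
    using braid_eq_context[OF braid_eq_inverse_right[OF assms(3)], of "w @ v" "[]"] assms
    by (intro braid_class_eqI) simp
  ultimately show ?thesis
    by (simp add: markov_equivalent_def r_into_equivclp)
qed

lemma word_markov_stabilize:
  assumes "1 \<le> n" "w \<in> braid_words n"
  shows "word_markov n w (Suc n) (w @ [(n, True)])"
proof -
  interpret group "braid_group (Suc n)"
    by (rule group_braid_group)
  have "sigma (Suc n) n [^]\<^bsub>braid_group (Suc n)\<^esub> (1 :: int) = braid_class (Suc n) [(n, True)]"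
    using assms by simp (simp add: sigma_def)
  then have "markov_move (n, braid_class n w) (Suc n, braid_class (Suc n) (w @ [(n, True)]))"
    using assms markov_move.stabilization[of n "braid_class n w" 1]
    by (simp add: add_strand_class braid_group_mult braid_words_mono[of n "Suc n"])
  then show ?thesis
    by (simp add: markov_equivalent_def r_into_equivclp)
qed

lemma pass_product_destabilize:
  assumes "1 \<le> k" "1 \<le> a" "\<And>i. i \<in> {1..a} \<Longrightarrow> h i \<in> braid_words k"
  shows "word_markov (k + a) (pass_product k (k + a) h a)
    (k + a - 1) (h a @ pass_product k (k + a - 1) h (a - 1))"
proof -
  define n where "n = k + a - 1"
  have n: "k + a = Suc n" "k \<le> n" "1 \<le> n" "Suc n - a = k"
    using assms by (auto simp: n_def)
  define Q where "Q = pass_product k n h (a - 1)"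
  \<comment> \<open>\<open>N\<close> is the last pass on \<open>n\<close> strands, \<open>D\<close>
    is its inverse, and the full descending word is the letter \<open>n\<close> followed by
    \<open>D\<close>.\<close>
  define N where "N = neg_word k n"
  define D where "D = rev (pos_word k n)"
  have "Q \<in> braid_words n"
    unfolding Q_def using assms n by (intro pass_product_in) auto
  moreover have "h a \<in> braid_words n"
    using assms n by (intro braid_words_mono[of k n]) auto
  ultimately have words: "Q \<in> braid_words n" "h a \<in> braid_words n" "N \<in> braid_words n" "D \<in> braid_words n"
    using assms by (simp_all add: N_def D_def)
  have words_Suc: "w \<in> braid_words n \<Longrightarrow> w \<in> braid_words (Suc n)" for w
    by (rule braid_words_mono) auto
  \<comment> \<open>Since \<open>n + 1 - a = k\<close>, the positive part of this pass is
    empty.\<close>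
  have "pass k n a = N"
    using n by (simp add: pass_def N_def pos_word_def)
  then have "pass_product k n h a = Q @ h a @ N"
    using assms(2) pass_product_Suc[of k n h "a - 1"] by (simp add: Q_def)
  moreover have "rev (pos_word k (Suc n)) = (n, True) # D"
    using n pos_word_append[of k n "Suc n"] by (simp add: D_def)
  ultimately have "braid_eq (Suc n) (pass_product k (Suc n) h a) ((Q @ h a @ N @ [(n, True)]) @ D)"
    using pass_product_descend[of k a n h] assms n by simp
  then have "word_markov (Suc n) (pass_product k (Suc n) h a) (Suc n) ((Q @ h a @ N @ [(n, True)]) @ D)"
    by (rule word_markov_braid_eq)
  \<comment> \<open>Rotating \<open>D\<close> to the front leaves the letter \<open>n\<close> last,
    after a word on \<open>n\<close> strands, as destabilization requires. Rotating \<open>D\<close>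
    back afterwards places it next to \<open>N\<close>, where the two cancel.\<close>
  also have "word_markov (Suc n) ((Q @ h a @ N @ [(n, True)]) @ D) (Suc n) (D @ Q @ h a @ N @ [(n, True)])"
    using words n by (intro word_markov_rotate) (auto intro: words_Suc)
  also have "word_markov (Suc n) (D @ Q @ h a @ N @ [(n, True)]) n (D @ Q @ h a @ N)"
    using word_markov_stabilize[of n "D @ Q @ h a @ N"] words n by (simp add: markov_sym)
  also have "word_markov n (D @ Q @ h a @ N) n ((Q @ h a @ N) @ D)"
    using words n by (intro word_markov_rotate) auto
  also have "word_markov n ((Q @ h a @ N) @ D) n (Q @ h a)"
    using braid_eq_context[OF braid_eq_inverse_right[of N n], of "Q @ h a" "[]"] words
    by (intro word_markov_braid_eq) (simp add: N_def D_def inverse_word_neg_word)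
  also have "word_markov n (Q @ h a) n (h a @ Q)"
    using words n by (intro word_markov_rotate)
  finally show ?thesis
    by (simp add: n_def[symmetric] n(1) Q_def)
qed

text \<open>The free \<open>f\<close> serves two uses: the passes, and the empty word for the plain
  product of the \<open>h i\<close>.\<close>

lemma concat_map_upt_absorb:
  assumes "1 \<le> m"
  shows "concat (map (\<lambda>i. (h(1 := w @ h 1)) i @ f i) [1..<m + 1]) =
    w @ concat (map (\<lambda>i. h i @ f i) [1..<m + 1])"
proof -
  have "[1..<m + 1] = 1 # [2..<m + 1]"
    using assms by (simp add: upt_conv_Cons numeral_2_eq_2)
  moreover have "map (\<lambda>i. (h(1 := w @ h 1)) i @ f i) [2..<m + 1] = map (\<lambda>i. h i @ f i) [2..<m + 1]"
    by (rule map_cong) auto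
  ultimately show ?thesis
    by (simp only: list.map concat.simps) simp
qed

text \<open>\<open>h\<close> is arbitrary in the induction because the step replaces
  \<open>h 1\<close> by \<open>h (Suc a) @ h 1\<close>, which need not have the form of an eta
  word.\<close>

lemma pass_product_markov:
  assumes "1 \<le> k" "1 \<le> a" "\<And>i. i \<in> {1..a} \<Longrightarrow> h i \<in> braid_words k"
  shows "word_markov (k + a) (pass_product k (k + a) h a) k (concat (map h [1..<a + 1]))"
  using assms(2,3)
proof (induction a arbitrary: h rule: nat_induct_at_least)
  case base
  then show ?case
    \<comment> \<open>With one factor, the product left after destabilization is empty, so only
      \<open>h 1\<close> remains.\<close>
    using pass_product_destabilize[of k 1 h] assms(1) by (simp add: pass_product_def)
next
  case (Suc a)
  define h' where "h' = h(1 := h (Suc a) @ h 1)"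
  have "word_markov (k + Suc a) (pass_product k (k + Suc a) h (Suc a))
      (k + a) (h (Suc a) @ pass_product k (k + a) h a)"
    using pass_product_destabilize[of k "Suc a" h] assms(1) Suc.prems by simp
  also have "h (Suc a) @ pass_product k (k + a) h a = pass_product k (k + a) h' a"
    unfolding h'_def pass_product_def by (rule concat_map_upt_absorb[OF Suc.hyps, symmetric])
  also have "word_markov (k + a) (pass_product k (k + a) h' a) k (concat (map h' [1..<a + 1]))"
    using Suc.hyps Suc.prems by (intro Suc.IH) (auto simp: h'_def)
  also have "concat (map h' [1..<a + 1]) = h (Suc a) @ concat (map h [1..<a + 1])"
    using concat_map_upt_absorb[OF Suc.hyps, of h _ "\<lambda>_. []"] unfolding h'_def append_Nil2 .
  \<comment> \<open>One more rotation returns \<open>h (Suc a)\<close> to its place at the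
    end.\<close>
  also have "word_markov k (h (Suc a) @ concat (map h [1..<a + 1])) k
      (concat (map h [1..<a + 1]) @ h (Suc a))"
    using assms(1) Suc.prems by (intro word_markov_rotate concat_map_in_braid_words) auto
  finally show ?case
    by simp
qed

section \<open>From products in the braid group to words\<close>

lemma ordered_prod_braid_class:
  assumes "\<And>i. i \<in> set is \<Longrightarrow> F i = braid_class n (f i)" "\<And>i. i \<in> set is \<Longrightarrow> f i \<in> braid_words n"
  shows "ordered_prod (braid_group n) (map F is) = braid_class n (concat (map f is))"
  using assms
  by (induction "is")
     (simp_all add: ordered_prod_def braid_group_one braid_group_mult concat_map_in_braid_words)

lemma eta_braid_class:
  assumes "m < n" "\<And>j. j \<in> {1..m} \<Longrightarrow> e j \<in> {1, -1}"
  shows "eta n m e = braid_class n (map (\<lambda>j. (j, e j = 1)) [1..<m + 1])"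
proof -
  interpret group "braid_group n"
    by (rule group_braid_group)
  have "sigma n j [^]\<^bsub>braid_group n\<^esub> e j = braid_class n [(j, e j = 1)]" if "j \<in> {1..m}" for j
  proof -
    have "sigma n j \<in> carrier (braid_group n)" and j: "1 \<le> j" "j < n"
      using that assms(1) by auto
    then show ?thesis
      using assms(2)[OF that]
      by (auto simp: int_pow_neg) (simp_all add: sigma_def inv_braid_class inverse_word_def)
  qed
  then have "eta n m e = braid_class n (concat (map (\<lambda>j. [(j, e j = 1)]) [1..<m + 1]))"
    unfolding eta_def using assms(1) by (intro ordered_prod_braid_class) auto
  then show ?thesis
    by simp
qed

lemma kappa_braid_class:
  assumes "1 \<le> k" "j < n"
  shows "kappa n k j = braid_class n (pos_word k (j + 1))"
proof -
  have "kappa n k j = braid_class n (concat (map (\<lambda>i. [(i, True)]) [k..<j + 1]))"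
    unfolding kappa_def using assms by (intro ordered_prod_braid_class) (auto simp: sigma_def)
  then show ?thesis
    by (simp add: pos_word_def)
qed

lemma neg_run_braid_class:
  assumes "1 \<le> k" "j < n"
  shows "neg_run n k j = braid_class n (neg_word k (j + 1))"
proof -
  have "neg_run n k j = braid_class n (concat (map (\<lambda>i. [(i, False)]) [k..<j + 1]))"
    unfolding neg_run_def using assms
    by (intro ordered_prod_braid_class) (auto simp: sigma_def inv_braid_class inverse_word_def)
  then show ?thesis
    by (simp add: neg_word_def)
qed

theorem theorem1p2:
  fixes p a :: nat and g :: "nat \<Rightarrow> nat \<Rightarrow> int"
  assumes "1 \<le> a" and "a < p"
    and "\<And>i j. i \<in> {1..a} \<Longrightarrow> j \<in> {1..p - a - 1} \<Longrightarrow> g i j \<in> {1, -1}"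
  shows
    "(p, ordered_prod (braid_group p)
           (map (\<lambda>i. eta p (p - a - 1) (g i) \<otimes>\<^bsub>braid_group p\<^esub> kappa p (p - a) (p - i)
                       \<otimes>\<^bsub>braid_group p\<^esub> neg_run p (p - i + 1) (p - 1))
              [1..<a + 1]))
     \<sim>\<^sub>M (p - a, ordered_prod (braid_group (p - a)) (map (\<lambda>i. eta (p - a) (p - a - 1) (g i)) [1..<a + 1]))"
proof -
  define k where "k = p - a"
  \<comment> \<open>One word represents the i-th eta on both \<open>p\<close> and
    \<open>p - a\<close> strands; the exponent -1 becomes the sign \<open>False\<close>.\<close>
  define h where "h i = map (\<lambda>j. (j, g i j = 1)) [1..<k]" for i
  have k: "1 \<le> k" "k \<le> p" "p = k + a"
    using assms by (auto simp: k_def)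
  have h: "h i \<in> braid_words n" if "k \<le> n" for i n
    using that by (auto simp: h_def braid_words_def lists_eq_set)
  have eta: "eta n (k - 1) (g i) = braid_class n (h i)" if "k \<le> n" "i \<in> {1..a}" for i n
    using eta_braid_class[of "k - 1" n "g i"] assms(3)[OF that(2)] that(1) k
    by (simp add: h_def flip: k_def)
  have "eta p (k - 1) (g i) \<otimes>\<^bsub>braid_group p\<^esub> kappa p k (p - i) \<otimes>\<^bsub>braid_group p\<^esub>
      neg_run p (p - i + 1) (p - 1) = braid_class p (h i @ pass k p i)" if "i \<in> {1..a}" for i
  proof -
    have "eta p (k - 1) (g i) = braid_class p (h i)"
      using that k by (intro eta) auto
    \<comment> \<open>The last index of \<open>kappa\<close> is included, so the half-open word ends
      at \<open>p + 1 - i\<close>, where the negative run starts; that run is empty for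
      \<open>i = 1\<close>.\<close>
    moreover have "kappa p k (p - i) = braid_class p (pos_word k (p + 1 - i))"
      using that k kappa_braid_class[of k "p - i" p] by (simp add: Suc_diff_le)
    moreover have "neg_run p (p - i + 1) (p - 1) = braid_class p (neg_word (p + 1 - i) p)"
      using that k neg_run_braid_class[of "p - i + 1" "p - 1" p] by (simp add: Suc_diff_le)
    moreover have "pos_word k (p + 1 - i) \<in> braid_words p" "neg_word (p + 1 - i) p \<in> braid_words p"
      using that k by auto
    ultimately show ?thesis
      using h[OF k(2), of i] by (simp add: braid_group_mult pass_def)
  qed
  then have "ordered_prod (braid_group p)
      (map (\<lambda>i. eta p (k - 1) (g i) \<otimes>\<^bsub>braid_group p\<^esub> kappa p k (p - i)
        \<otimes>\<^bsub>braid_group p\<^esub> neg_run p (p - i + 1) (p - 1)) [1..<a + 1]) =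
      braid_class p (pass_product k p h a)"
    unfolding pass_product_def using k h by (intro ordered_prod_braid_class) auto
  moreover have "ordered_prod (braid_group k) (map (\<lambda>i. eta k (k - 1) (g i)) [1..<a + 1]) =
      braid_class k (concat (map h [1..<a + 1]))"
    using eta h by (intro ordered_prod_braid_class) auto
  moreover have "word_markov (k + a) (pass_product k (k + a) h a) k (concat (map h [1..<a + 1]))"
    using assms(1) k h by (intro pass_product_markov) auto
  ultimately show ?thesis
    by (simp add: k(3) flip: k_def)
qed

end
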